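(* Let $\mathbb{X}$ be a real normed linear space. Let $f,g\in\mathbb{X}^{*}$ be such that $f\perp_B g$. Let $\epsilon>0$ be arbitrary but fixed after choice. Then $$\|f\|=\max\{l(\epsilon),k_1\}=\max\{l(\epsilon),k_2\},$$ where $l(\epsilon)=\sup\{f(x):x\in S_{\mathbb{X}},\ |g(x)|<\epsilon\}$, $k_1=\sup\{f(x):x\in S_{\mathbb{X}},\ g(x)\ge 0\}$, $k_2=\sup\{f(x):x\in S_{\mathbb{X}},\ g(x)\le 0\}$.
   Context: All normed spaces are real; $S_{\mathbb{X}}=\{x\in\mathbb{X}:\|x\|=1\}$, and $\mathbb{X}^{*}$ is the space of bounded linear functionals on $\mathbb{X}$ with the dual norm. $f\perp_B g$ (Birkhoff-James orthogonality) means $\|f+\lambda g\|\ge\|f\|$ for all $\lambda\in\mathbb{R}$. *)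

theory Defs
  imports "HOL-Analysis.Analysis"
begin

definition birkhoff_orthogonal :: "'a::real_normed_vector \<Rightarrow> 'a \<Rightarrow> bool"
    (infix "\<bottom>\<^sub>B" 50) where
  "f \<bottom>\<^sub>B g \<longleftrightarrow> (\<forall>c::real. norm (f + c *\<^sub>R g) \<ge> norm f)"

abbreviation unit_sphere :: "'a::real_normed_vector set" where
  "unit_sphere \<equiv> sphere 0 1"

(* The suprema are taken in the extended reals, so that the supremum of the empty set is
   -infinity. The index set of l_sup can be empty: e.g. if the space is one-dimensional,
   g is nonzero and e is at most norm g. Every other supremum below is finite as soon as
   the space is nonzero. *)

definition l_sup ::
    "('a::real_normed_vector \<Rightarrow>\<^sub>L real) \<Rightarrow> ('a \<Rightarrow>\<^sub>L real) \<Rightarrow> real \<Rightarrow> ereal" where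
  "l_sup f g e = (SUP x \<in> {x \<in> unit_sphere. \<bar>blinfun_apply g x\<bar> < e}. ereal (blinfun_apply f x))"

definition k1_sup ::
    "('a::real_normed_vector \<Rightarrow>\<^sub>L real) \<Rightarrow> ('a \<Rightarrow>\<^sub>L real) \<Rightarrow> ereal" where
  "k1_sup f g = (SUP x \<in> {x \<in> unit_sphere. blinfun_apply g x \<ge> 0}. ereal (blinfun_apply f x))"

definition k2_sup ::
    "('a::real_normed_vector \<Rightarrow>\<^sub>L real) \<Rightarrow> ('a \<Rightarrow>\<^sub>L real) \<Rightarrow> ereal" where
  "k2_sup f g = (SUP x \<in> {x \<in> unit_sphere. blinfun_apply g x \<le> 0}. ereal (blinfun_apply f x))"

end

theory Submission
  imports Defs
begin

text \<open>
  For small \<open>t > 0\<close>, orthogonality provides a unit vector \<open>x\<close> with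
  \<open>f x + t * g x > norm f - t\<^sup>2\<close>. As \<open>f x \<le> norm f\<close>, this forces \<open>g x > - t\<close>, so \<open>x\<close> satisfies
  \<open>g x \<ge> 0\<close> or \<open>\<bar>g x\<bar> < t\<close>; and \<open>f x > norm f - t\<^sup>2 - t * norm g\<close> is close to \<open>norm f\<close>.
  Replacing \<open>g\<close> by \<open>- g\<close> exchanges \<open>k\<^sub>1\<close> and \<open>k\<^sub>2\<close>.
\<close>

lemma blinfun_apply_le_norm_unit:
  fixes h :: "'a::real_normed_vector \<Rightarrow>\<^sub>L real"
  assumes "norm x = 1"
  shows "blinfun_apply h x \<le> norm h"
  using norm_blinfun[of h x] assms by simp

text \<open>If \<open>c\<close> bounds \<open>h\<close> on the unit sphere, symmetry under
  \<open>x\<close> to \<open>- x\<close> makes it bound the absolute value there, and homogeneity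
  then gives \<open>norm h \<le> c\<close>.\<close>

lemma norm_blinfun_approx_unit:
  fixes h :: "'a::real_normed_vector \<Rightarrow>\<^sub>L real"
  assumes nontrivial: "\<exists>x::'a. x \<noteq> 0" and "c < norm h"
  obtains x where "norm x = 1" and "c < blinfun_apply h x"
proof (rule ccontr)
  assume "\<not> thesis"
  with that have le: "blinfun_apply h x \<le> c" if "norm x = 1" for x
    using \<open>norm x = 1\<close> by fastforce
  have abs_le: "\<bar>blinfun_apply h x\<bar> \<le> c" if "norm x = 1" for x
    using le[of x] le[of "- x"] that by (simp add: blinfun.minus_right)
  \<comment> \<open>Nontriviality supplies a unit vector, which forces \<open>c\<close> to be
    nonnegative. In the zero space the sphere is empty and a negative \<open>c\<close> would refute
    the claim.\<close>
  obtain u :: 'a where "u \<noteq> 0" using nontrivial by blast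
  then have "0 \<le> c"
    using abs_le[of "sgn u"] by (simp add: norm_sgn)
  moreover have "norm (blinfun_apply h x) \<le> c * norm x" for x
  proof (cases "x = 0")
    case False
    then have "\<bar>blinfun_apply h (sgn x)\<bar> \<le> c"
      by (intro abs_le) (simp add: norm_sgn)
    with False show ?thesis
      by (simp add: sgn_div_norm blinfun.scaleR_right abs_mult field_simps)
  qed (simp add: blinfun.zero_right)
  ultimately have "norm h \<le> c" by (rule norm_blinfun_bound)
  with \<open>c < norm h\<close> show False by simp
qed

lemma birkhoff_orthogonal_approx_unit:
  fixes f g :: "'a::real_normed_vector \<Rightarrow>\<^sub>L real"
  assumes nontrivial: "\<exists>x::'a. x \<noteq> 0" and orth: "f \<bottom>\<^sub>B g"
    and "e > 0" and "c < norm f"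
  obtains x where "norm x = 1" and "- e < blinfun_apply g x" and "c < blinfun_apply f x"
proof -
  \<comment> \<open>Each entry of the minimum serves one estimate: \<open>1\<close> gives
    \<open>t * t \<le> t\<close>, \<open>e\<close> turns \<open>- t < g x\<close> into
    \<open>- e < g x\<close>, and the quotient keeps the total loss \<open>t + t * norm g\<close>
    within \<open>norm f - c\<close>.\<close>
  define t where "t = Min {1, e, (norm f - c) / (1 + norm g)}"
  have g_pos: "0 < 1 + norm g" by (simp add: add_pos_nonneg)
  have t: "0 < t" "t \<le> 1" "t \<le> e" "t \<le> (norm f - c) / (1 + norm g)"
    using \<open>e > 0\<close> \<open>c < norm f\<close> g_pos by (auto simp: t_def)
  have small: "t * (1 + norm g) \<le> norm f - c"
    using t(4) g_pos by (simp add: pos_le_divide_eq)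
  have "norm f \<le> norm (f + t *\<^sub>R g)"
    using orth by (simp add: birkhoff_orthogonal_def)
  \<comment> \<open>The slack is quadratic in \<open>t\<close> so that an error of only
    \<open>t\<close> remains in the bound on \<open>g x\<close> after division by
    \<open>t\<close>.\<close>
  then have "norm f - t * t < norm (f + t *\<^sub>R g)"
    using mult_pos_pos[OF t(1) t(1)] by linarith
  then obtain x where x: "norm x = 1" "norm f - t * t < blinfun_apply (f + t *\<^sub>R g) x"
    by (rule norm_blinfun_approx_unit[OF nontrivial])
  then have *: "norm f - t * t < blinfun_apply f x + t * blinfun_apply g x"
    by (simp add: blinfun.add_left blinfun.scaleR_left)
  have "t * (- t) < t * blinfun_apply g x"
    using * blinfun_apply_le_norm_unit[OF x(1), of f] by simp
  then have "- t < blinfun_apply g x"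
    using t(1) by (simp only: mult_less_cancel_left_pos)
  moreover have "c < blinfun_apply f x"
  proof -
    have "t * blinfun_apply g x \<le> t * norm g"
      using t(1) blinfun_apply_le_norm_unit[OF x(1), of g] by simp
    moreover have "t * t \<le> t" using t(1,2) by (simp add: mult_left_le)
    ultimately show ?thesis using * small by (simp add: distrib_left)
  qed
  ultimately show thesis using that x(1) t(3) by fastforce
qed

text \<open>A vector with \<open>- e < g x\<close> lies in one of the two index sets according to
  the sign of \<open>g x\<close>, and such vectors bring \<open>f x\<close> arbitrarily close to
  \<open>norm f\<close>.\<close>

lemma norm_eq_max_l_sup_k1_sup:
  fixes f g :: "'a::real_normed_vector \<Rightarrow>\<^sub>L real"
  assumes nontrivial: "\<exists>x::'a. x \<noteq> 0" and orth: "f \<bottom>\<^sub>B g" and "e > 0"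
  shows "ereal (norm f) = max (l_sup f g e) (k1_sup f g)"
proof (rule antisym)
  show "max (l_sup f g e) (k1_sup f g) \<le> ereal (norm f)"
    by (auto simp: l_sup_def k1_sup_def intro!: SUP_least blinfun_apply_le_norm_unit)
  show "ereal (norm f) \<le> max (l_sup f g e) (k1_sup f g)"
  \<comment> \<open>Testing against real upper bounds \<open>z\<close> of the maximum avoids a case
    split on infinite suprema.\<close>
  proof (rule ereal_le_real)
    fix z assume z: "max (l_sup f g e) (k1_sup f g) \<le> ereal z"
    show "ereal (norm f) \<le> ereal z"
    proof (rule ccontr)
      assume "\<not> ereal (norm f) \<le> ereal z"
      then have "z < norm f" by simp
      then obtain x where x: "norm x = 1" "- e < blinfun_apply g x" "z < blinfun_apply f x"
        by (rule birkhoff_orthogonal_approx_unit[OF nontrivial orth \<open>e > 0\<close>])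
      have "ereal (blinfun_apply f x) \<le> max (l_sup f g e) (k1_sup f g)"
      proof (cases "blinfun_apply g x \<ge> 0")
        case True
        with x(1) have "ereal (blinfun_apply f x) \<le> k1_sup f g"
          unfolding k1_sup_def by (intro SUP_upper) simp
        then show ?thesis by (simp add: le_max_iff_disj)
      next
        case False
        with x(1,2) have "ereal (blinfun_apply f x) \<le> l_sup f g e"
          unfolding l_sup_def by (intro SUP_upper) simp
        then show ?thesis by (simp add: le_max_iff_disj)
      qed
      also note z
      finally show False using x(3) by simp
    qed
  qed
qed

text \<open>The scalar ranges over all reals, so its sign can absorb that of \<open>g\<close>. This
  lets the equation for \<open>k1_sup\<close> be applied to \<open>- g\<close>.\<close>

lemma birkhoff_orthogonal_minus_right:
  assumes "f \<bottom>\<^sub>B g"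
  shows "f \<bottom>\<^sub>B - g"
  unfolding birkhoff_orthogonal_def
proof
  fix c
  show "norm f \<le> norm (f + c *\<^sub>R - g)"
    using assms[unfolded birkhoff_orthogonal_def, rule_format, of "- c"] by simp
qed

lemma l_sup_minus_right: "l_sup f (- g) e = l_sup f g e"
  by (simp add: l_sup_def blinfun.minus_left)

lemma k1_sup_minus_right: "k1_sup f (- g) = k2_sup f g"
  by (simp add: k1_sup_def k2_sup_def blinfun.minus_left)

theorem theorem2p8:
  fixes f g :: "'a::real_normed_vector \<Rightarrow>\<^sub>L real"
    and \<epsilon> :: real
  assumes "\<exists>x::'a. x \<noteq> 0"
    and "f \<bottom>\<^sub>B g"
    and "\<epsilon> > 0"
  shows "ereal (norm f) = max (l_sup f g \<epsilon>) (k1_sup f g)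
       \<and> ereal (norm f) = max (l_sup f g \<epsilon>) (k2_sup f g)"
  using norm_eq_max_l_sup_k1_sup[OF assms]
    norm_eq_max_l_sup_k1_sup[OF assms(1) birkhoff_orthogonal_minus_right[OF assms(2)] assms(3)]
  by (simp add: l_sup_minus_right k1_sup_minus_right)

end
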